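(* Let $P=P(p_1,p_2,p_3,p_4,p_5)$ be any pentatope in $\mathbb{R}^4$ with hypervolume $v$ and edge lengths $l_1,\dots,l_{10}$ (ordered as in the context). Let $A(R,T)$ be the $4\times 4$ matrix that compares $P$ with the regular pentatope of the same hypervolume (defined in the context), let $\lambda_1,\lambda_2,\lambda_3,\lambda_4$ be its eigenvalues, and let the quality of $P$ be the ratio of their geometric mean to their root-mean-square, $$\eta^{(3)} := \frac{2\sqrt[4]{\lambda_1\lambda_2\lambda_3\lambda_4}}{\sqrt{\lambda_1^2+\lambda_2^2+\lambda_3^2+\lambda_4^2}}.$$ Then $$\eta^{(3)} = 6\cdot 5^{3/4}\sqrt{\frac{384\,v}{\Theta\left(\{l_i^2\}_{i=1}^{10}\right)}},$$ where $\Theta$ is the function defined in the context.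
   Context: A pentatope is a (non-degenerate) 4-simplex in $\mathbb{R}^4$ with vertices $p_1,\dots,p_5$; $v>0$ denotes its 4-dimensional volume. Write $d_{ij}=\|p_j-p_i\|^2$ for $1\le i<j\le5$. The edge lengths are ordered so that $(l_1^2,l_2^2,\dots,l_{10}^2)=(d_{12},d_{13},d_{14},d_{15},d_{23},d_{24},d_{25},d_{34},d_{35},d_{45})$. The function $\Theta$ is $$\begin{aligned} \Theta\left(\{l_i^2\}_{i=1}^{10}\right) ={}& 600(l_1^2-l_2^2)^2+900\,l_5^4+100\bigl(-2(l_1^2+l_2^2)+l_5^2\bigr)^2\\ &+75(l_1^2-l_2^2-3l_6^2+3l_8^2)^2+25\bigl(l_1^2+l_2^2-3l_3^2+l_5^2-3(l_6^2+l_8^2)\bigr)^2\\ &+25\bigl(l_1^2+l_2^2-6l_3^2-2l_5^2+3(l_6^2+l_8^2)\bigr)^2\\ &+45(l_1^2-l_2^2+l_6^2-4l_7^2-l_8^2+4l_9^2)^2\\ &+15(l_1^2+l_2^2+2l_3^2-8l_4^2-2l_5^2-l_6^2+4l_7^2-l_8^2+4l_9^2)^2\\ &+30(-l_1^2-l_2^2+l_3^2+2l_4^2-l_5^2+l_6^2+2l_7^2+l_8^2+2l_9^2-6l_{10}^2)^2\\ &+9\bigl(l_1^2+l_2^2+l_3^2-4l_4^2+l_5^2+l_6^2-4l_7^2+l_8^2-4(l_9^2+l_{10}^2)\bigr)^2. \end{aligned}$$ Quality measures similarity between $P$ and a regular pentatope $P_r(r_1,\dots,r_5)$ with the same hypervolume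 $v$. The edge length of $P_r$ is $a=(96v/\sqrt5)^{1/4}$, and its vertices are $r_1=(-a\sqrt3/2,0,0,0)$, $r_2=(0,-a/2,0,0)$, $r_3=(0,a/2,0,0)$, $r_4=(-a\sqrt3/6,0,a\sqrt6/3,0)$, $r_5=(-a\sqrt3/6,0,a\sqrt6/12,a\sqrt{10}/4)$. Define the $4\times4$ matrices (by columns) $R=[\,r_2-r_1,\ r_3-r_1,\ r_4-r_1,\ r_5-r_1\,]$ and $T=[\,p_2-p_1,\ p_3-p_1,\ p_4-p_1,\ p_5-p_1\,]$, and set $$A(R,T)=(R^{-1})^{T}\,T^{T}T\,R^{-1},$$ where the superscript $T$ denotes transpose. *)

theory Defs
  imports "HOL-Analysis.Analysis" "HOL-Computational_Algebra.Polynomial"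
begin

text \<open>The vertices of a pentatope are \<open>p 1, \<dots>, p 5\<close>; other values of \<open>p\<close> are irrelevant.\<close>

definition pentatope :: "(nat \<Rightarrow> real^4) \<Rightarrow> bool" where
  "pentatope p \<longleftrightarrow> inj_on p {1..5} \<and> \<not> affine_dependent (p ` {1..5})"

definition hypervolume :: "(nat \<Rightarrow> real^4) \<Rightarrow> real" where
  "hypervolume p = measure lebesgue (convex hull (p ` {1..5}))"

text \<open>Edges are numbered \<open>1, \<dots>, 10\<close> in the lexicographic order of their end points.\<close>

definition edge_length :: "(nat \<Rightarrow> real^4) \<Rightarrow> nat \<Rightarrow> real" where
  "edge_length p i =
    (let (j, k) = [(1,2), (1,3), (1,4), (1,5), (2,3), (2,4), (2,5), (3,4), (3,5), (4,5)] ! (i - 1)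
     in norm (p k - p j))"

text \<open>The arguments \<open>s 1, \<dots>, s 10\<close> stand for the squared edge lengths, so that the
  fourth power of the fifth edge length is \<open>(s 5)\<^sup>2\<close>.\<close>

definition Theta :: "(nat \<Rightarrow> real) \<Rightarrow> real" where
  "Theta s =
     600 * (s 1 - s 2)\<^sup>2 + 900 * (s 5)\<^sup>2 + 100 * (- 2 * (s 1 + s 2) + s 5)\<^sup>2
   + 75 * (s 1 - s 2 - 3 * s 6 + 3 * s 8)\<^sup>2
   + 25 * (s 1 + s 2 - 3 * s 3 + s 5 - 3 * (s 6 + s 8))\<^sup>2
   + 25 * (s 1 + s 2 - 6 * s 3 - 2 * s 5 + 3 * (s 6 + s 8))\<^sup>2
   + 45 * (s 1 - s 2 + s 6 - 4 * s 7 - s 8 + 4 * s 9)\<^sup>2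
   + 15 * (s 1 + s 2 + 2 * s 3 - 8 * s 4 - 2 * s 5 - s 6 + 4 * s 7 - s 8 + 4 * s 9)\<^sup>2
   + 30 * (- s 1 - s 2 + s 3 + 2 * s 4 - s 5 + s 6 + 2 * s 7 + s 8 + 2 * s 9 - 6 * s 10)\<^sup>2
   + 9 * (s 1 + s 2 + s 3 - 4 * s 4 + s 5 + s 6 - 4 * s 7 + s 8 - 4 * (s 9 + s 10))\<^sup>2"

text \<open>The regular pentatope of hypervolume \<open>v\<close>; \<open>a\<close> is its edge length.\<close>

definition regular_pentatope :: "real \<Rightarrow> nat \<Rightarrow> real^4" where
  "regular_pentatope v i =
    (let a = root 4 (96 * v / sqrt 5) in
     [vector [- a * sqrt 3 / 2, 0, 0, 0],
      vector [0, - a / 2, 0, 0],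
      vector [0, a / 2, 0, 0],
      vector [- a * sqrt 3 / 6, 0, a * sqrt 6 / 3, 0],
      vector [- a * sqrt 3 / 6, 0, a * sqrt 6 / 12, a * sqrt 10 / 4]] ! (i - 1))"

text \<open>\<open>vector\<close> lists the rows of a matrix, hence the transposition to obtain columns.\<close>

definition edge_matrix :: "(nat \<Rightarrow> real^4) \<Rightarrow> real^4^4" where
  "edge_matrix p = transpose (vector [p 2 - p 1, p 3 - p 1, p 4 - p 1, p 5 - p 1])"

definition comparison_matrix :: "real^4^4 \<Rightarrow> real^4^4 \<Rightarrow> real^4^4" where
  "comparison_matrix R T = transpose (matrix_inv R) ** transpose T ** T ** matrix_inv R"

definition charpoly :: "'a::comm_ring_1^'n^'n \<Rightarrow> 'a poly" where
  "charpoly A = det (\<chi> i j. (if i = j then [:0, 1:] else 0) - [:A $ i $ j:])"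

text \<open>Real eigenvalues with algebraic multiplicity; for a symmetric matrix these are all of its
  eigenvalues, so that \<open>\<lambda>\<^sub>1, \<dots>, \<lambda>\<^sub>4\<close> is the multiset \<open>eigenvalues (comparison_matrix R T)\<close>.\<close>

definition eigenvalues :: "real^'n^'n \<Rightarrow> real multiset" where
  "eigenvalues A = proots (charpoly A)"

definition quality :: "(nat \<Rightarrow> real^4) \<Rightarrow> real" where
  "quality p =
    (let R = edge_matrix (regular_pentatope (hypervolume p));
         T = edge_matrix p;
         L = eigenvalues (comparison_matrix R T)
     in 2 * root 4 (\<Prod>x\<in>#L. x) / sqrt (\<Sum>x\<in>#L. x\<^sup>2))"

end

theory Submission
  imports Defs
begin

text \<open>
  Write \<open>G = T\<^sup>T T\<close> and \<open>H = R\<^sup>T R\<close> for the Gram matrices of the edge vectors at the first vertex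
  of the given and of the regular pentatope. The matrix \<open>A = (R\<^sup>-\<^sup>1)\<^sup>T G R\<^sup>-\<^sup>1\<close> is symmetric, so
  its characteristic polynomial splits over the reals by the spectral theorem. Hence the product
  of its eigenvalues is \<open>det A\<close> and the sum of their squares is \<open>trace (A\<^sup>2)\<close>.

  The determinant is \<open>(det T / det R)\<^sup>2\<close>. Both determinants are, up to sign, \<open>4! = 24\<close> times the
  hypervolume, and the two hypervolumes agree, so \<open>det A = 1\<close> and the geometric mean in the quality
  is \<open>1\<close>.

  For the trace, cyclic invariance gives \<open>trace (A\<^sup>2) = trace ((G H\<^sup>-\<^sup>1)\<^sup>2)\<close>. If \<open>a\<close> is the edge length
  of the regular pentatope, then \<open>H = a\<^sup>2/2 (I + J)\<close> with \<open>J\<close> the all-ones matrix, and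
  \<open>H\<^sup>-\<^sup>1 = 2/a\<^sup>2 (I - J/5)\<close>. The entries of \<open>G\<close> are linear in the squared edge lengths, and the
  quadratic form \<open>trace ((G (I - J/5))\<^sup>2)\<close> in them is \<open>\<Theta> / 3600\<close>: the ten squares in \<open>\<Theta>\<close> are a
  diagonalization of this form (\<open>Theta_eq_trace\<close>). With \<open>a\<^sup>4 = 96 v / \<surd>5\<close> this yields
  \<open>trace (A\<^sup>2) = \<surd>5 \<Theta> / (86400 v)\<close>, from which the claim follows by arithmetic.
\<close>

section \<open>The spectral theorem for real symmetric matrices\<close>

text \<open>
  The quadratic form \<open>x \<bullet> f x\<close> attains its maximum \<open>c\<close> over the unit sphere of \<open>S\<close> at some \<open>v\<close>.
  Then \<open>q x = c (x \<bullet> x) - x \<bullet> f x\<close> is nonnegative on \<open>S\<close> and vanishes at \<open>v\<close>, so its first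
  variation at \<open>v\<close> is zero in every direction of \<open>S\<close>; in the direction \<open>w = c v - f v\<close>,
  which lies in \<open>S\<close> by invariance, this variation is \<open>2 (w \<bullet> w)\<close>.
\<close>
lemma self_adjoint_invariant_subspace_eigenvector:
  fixes f :: "'a::euclidean_space \<Rightarrow> 'a"
  assumes f: "linear f" and adj: "\<And>x y. f x \<bullet> y = x \<bullet> f y"
    and S: "subspace S" "S \<noteq> {0}" and inv: "\<And>x. x \<in> S \<Longrightarrow> f x \<in> S"
  obtains v c where "v \<in> S" "norm v = 1" "f v = c *\<^sub>R v"
proof -
  interpret f: linear f by fact
  define K where "K = S \<inter> sphere 0 1"
  have "compact K"
    unfolding K_def using S(1) by (intro closed_Int_compact closed_subspace) auto
  moreover have "K \<noteq> {}"
  proof -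
    obtain x where x: "x \<in> S" "x \<noteq> 0"
      using S subspace_0 by blast
    then have "x /\<^sub>R norm x \<in> K"
      using S(1) by (auto simp: K_def subspace_scale)
    then show ?thesis by blast
  qed
  moreover have "continuous_on K (\<lambda>x. x \<bullet> f x)"
    using f by (intro continuous_on_inner continuous_on_id linear_continuous_on)
      (simp add: linear_conv_bounded_linear)
  ultimately obtain v where v: "v \<in> K" "\<And>x. x \<in> K \<Longrightarrow> x \<bullet> f x \<le> v \<bullet> f v"
    using continuous_attains_sup by metis
  define c where "c = v \<bullet> f v"
  have vS: "v \<in> S" and nv: "norm v = 1"
    using v(1) by (auto simp: K_def)
  define q where "q x = c * (x \<bullet> x) - x \<bullet> f x" for x
  have q_nonneg: "0 \<le> q x" if "x \<in> S" for x
  proof (cases "x = 0")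
    case False
    have "x /\<^sub>R norm x \<in> K"
      using False that S(1) by (auto simp: K_def subspace_scale)
    from v(2)[OF this] have "(x \<bullet> f x) / (norm x)\<^sup>2 \<le> c"
      by (simp add: f.scaleR c_def power2_eq_square divide_simps mult_ac)
    then show ?thesis
      using False by (simp add: q_def divide_le_eq power2_norm_eq_inner)
  qed (simp add: q_def f.zero)
  define w where "w = c *\<^sub>R v - f v"
  have wS: "w \<in> S"
    unfolding w_def using vS inv S(1) by (intro subspace_diff subspace_scale) auto
  have qt: "q (v + t *\<^sub>R w) = 2 * t * (w \<bullet> w) + t\<^sup>2 * q w" for t
  proof -
    have "v \<bullet> v = 1"
      using nv by (simp add: norm_eq_1)
    moreover have "v \<bullet> f w = w \<bullet> f v"
      by (metis adj inner_commute)
    moreover have "w \<bullet> w = c * (w \<bullet> v) - w \<bullet> f v"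
      by (subst (2) w_def) (simp add: inner_diff_right)
    moreover have "v \<bullet> f v = c"
      by (simp add: c_def)
    ultimately show ?thesis
      unfolding q_def
      by (simp add: f.add f.scaleR inner_add_left inner_add_right inner_commute[of v w])
         (simp add: algebra_simps power2_eq_square)
  qed
  have "w \<bullet> w = 0"
  proof -
    \<comment> \<open>For this \<open>t\<close> the value \<open>q (v + t w)\<close> equals \<open>- t\<^sup>2 (2 + q w)\<close>, so nonnegativity forces \<open>t = 0\<close>.\<close>
    define t where "t = - (w \<bullet> w) / (1 + q w)"
    have "1 + q w > 0"
      using q_nonneg[OF wS] by simp
    then have "(1 + q w) * t = - (w \<bullet> w)"
      by (simp add: t_def)
    then have "2 * t * (w \<bullet> w) + t\<^sup>2 * q w = - t\<^sup>2 * (2 + q w)"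
      by algebra
    moreover have "0 \<le> q (v + t *\<^sub>R w)"
      using vS wS S(1) by (intro q_nonneg subspace_add subspace_scale)
    ultimately have "t\<^sup>2 * (2 + q w) \<le> 0"
      by (simp add: qt)
    then have "t = 0"
      using q_nonneg[OF wS] by (auto simp: mult_le_0_iff)
    then show ?thesis
      using \<open>(1 + q w) * t = - (w \<bullet> w)\<close> by simp
  qed
  then have "f v = c *\<^sub>R v"
    by (simp add: w_def)
  then show ?thesis
    using that vS nv by blast
qed

text \<open>
  Take an orthonormal set \<open>B\<close> of eigenvectors of maximal cardinality. Its orthogonal complement is
  invariant because \<open>f\<close> is self-adjoint; if the complement were nonzero, it would contain a
  further unit eigenvector, contradicting maximality.
\<close>
lemma self_adjoint_orthonormal_eigenbasis:
  fixes f :: "'a::euclidean_space \<Rightarrow> 'a"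
  assumes f: "linear f" and adj: "\<And>x y. f x \<bullet> y = x \<bullet> f y"
  obtains B where "finite B" "card B = DIM('a)" "pairwise orthogonal B" "\<And>b. b \<in> B \<Longrightarrow> norm b = 1"
    "\<And>b. b \<in> B \<Longrightarrow> \<exists>c. f b = c *\<^sub>R b"
proof -
  interpret f: linear f by fact
  define P where "P B \<longleftrightarrow> pairwise orthogonal B \<and> (\<forall>b\<in>B. norm b = 1 \<and> (\<exists>c. f b = c *\<^sub>R b))"
    for B
  have indep: "independent B" if "P B" for B
    using that by (intro pairwise_orthogonal_independent) (auto simp: P_def)
  have "P {}"
    by (simp add: P_def)
  moreover have "\<forall>B. P B \<longrightarrow> card B < Suc DIM('a)"
    using indep independent_bound by (auto simp: less_Suc_eq_le)
  ultimately obtain B where B: "P B" and max: "\<And>C. P C \<Longrightarrow> card C \<le> card B"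
    using ex_has_greatest_nat[of P "{}" card "Suc DIM('a)"] by blast
  have fin: "finite B"
    using indep[OF B] independent_bound by blast
  have "card B = DIM('a)"
  proof (rule ccontr)
    assume "card B \<noteq> DIM('a)"
    then have "dim B < DIM('a)"
      using indep[OF B] independent_bound[OF indep[OF B]] by (simp add: dim_eq_card_independent)
    then obtain x where x: "x \<noteq> 0" "\<And>y. y \<in> span B \<Longrightarrow> orthogonal x y"
      using orthogonal_to_subspace_exists by blast
    define S where "S = {y. \<forall>b\<in>B. orthogonal b y}"
    have "subspace S"
      unfolding S_def by (rule subspace_orthogonal_to_vectors)
    moreover have "S \<noteq> {0}"
      using x by (auto simp: S_def orthogonal_commute span_base)
    moreover have "f y \<in> S" if "y \<in> S" for y
      using that B by (force simp: S_def P_def orthogonal_def adj[symmetric])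
    ultimately obtain v c where v: "v \<in> S" "norm v = 1" "f v = c *\<^sub>R v"
      using self_adjoint_invariant_subspace_eigenvector[OF f adj] by metis
    have "v \<notin> B"
      using v by (auto simp: S_def orthogonal_def norm_eq_1)
    have "P (insert v B)"
      using B v by (auto simp: P_def S_def pairwise_insert orthogonal_commute)
    from max[OF this] show False
      using \<open>v \<notin> B\<close> fin by simp
  qed
  then show ?thesis
    using that B fin by (auto simp: P_def)
qed

lemma symmetric_matrix_orthogonally_diagonalizable:
  fixes A :: "real^'n^'n"
  assumes "transpose A = A"
  obtains Q d where "orthogonal_matrix Q" "A ** Q = Q ** (\<chi> i j. if i = j then d i else 0)"
proof -
  have adj: "(A *v x) \<bullet> y = x \<bullet> (A *v y)" for x y
    by (metis assms dot_lmul_matrix transpose_matrix_vector)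
  obtain B where B: "finite B" "card B = CARD('n)" "pairwise orthogonal B"
      "\<And>b. b \<in> B \<Longrightarrow> norm b = 1" "\<And>b. b \<in> B \<Longrightarrow> \<exists>c. A *v b = c *\<^sub>R b"
    using self_adjoint_orthonormal_eigenbasis[OF matrix_vector_mul_linear[of A] adj]
    by (metis DIM_cart DIM_real mult.right_neutral)
  obtain u where u: "bij_betw u (UNIV :: 'n set) B"
    using B(1,2) by (metis finite_same_card_bij finite_class.finite_UNIV)
  then have uB: "u i \<in> B" for i
    by (auto simp: bij_betw_def)
  obtain d where d: "\<And>i. A *v u i = d i *\<^sub>R u i"
    using B(5)[OF uB] by metis
  define Q :: "real^'n^'n" where "Q = (\<chi> i j. u j $ i)"
  have col: "column j Q = u j" for j
    by (simp add: Q_def column_def vec_eq_iff)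
  have "orthogonal_matrix Q"
    unfolding orthogonal_matrix_orthonormal_columns col
    using B(3,4) uB bij_betw_imp_inj_on[OF u] by (metis injD pairwiseD)
  moreover have "A ** Q = Q ** (\<chi> i j. if i = j then d i else 0)"
  proof -
    have "(A ** Q) $ i $ j = (A *v u j) $ i" for i j
      by (simp add: matrix_matrix_mult_def matrix_vector_mult_def Q_def)
    moreover have "(Q ** (\<chi> i j. if i = j then d i else 0)) $ i $ j = (d j *\<^sub>R u j) $ i" for i j
      by (simp add: matrix_matrix_mult_def Q_def if_distrib[of "\<lambda>x. _ * x"] cong: if_cong)
    ultimately show ?thesis
      by (simp add: vec_eq_iff d)
  qed
  ultimately show ?thesis
    using that by blast
qed

section \<open>Determinant and trace in terms of the eigenvalues\<close>

text \<open>
  Lift the matrices to constant polynomials by \<open>P\<close>. The scalar matrix \<open>X\<close> commutes with everything,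
  so \<open>P Q\<close> intertwines \<open>X - P A\<close> with \<open>X - P D\<close>, and \<open>det (P Q)\<close> is a unit.
\<close>
lemma charpoly_similar:
  fixes A D Q Q' :: "'a::comm_ring_1^'n^'n"
  assumes AQ: "A ** Q = Q ** D" and Q: "Q ** Q' = mat 1"
  shows "charpoly A = charpoly D"
proof -
  define P :: "'a^'n^'n \<Rightarrow> 'a poly^'n^'n" where "P M = (\<chi> i j. [:M $ i $ j:])" for M
  define X :: "'a poly^'n^'n" where "X = (\<chi> i j. if i = j then [:0, 1:] else 0)"
  have charpoly: "charpoly M = det (X - P M)" for M
    by (simp add: charpoly_def X_def P_def minus_vec_def vec_lambda_beta)
  have P_mult: "P (M ** N) = P M ** P N" for M N
  proof -
    have const_sum: "[:sum g UNIV:] = (\<Sum>k\<in>UNIV. [:g k:])" for g :: "'n \<Rightarrow> 'a"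
      by (simp add: poly_eq_iff coeff_sum coeff_pCons split: nat.split)
    show ?thesis
      by (simp add: P_def matrix_matrix_mult_def vec_eq_iff const_sum mult.commute)
  qed
  have X_comm: "X ** M = M ** X" for M
    by (simp add: X_def matrix_matrix_mult_def vec_eq_iff if_distrib[of "\<lambda>x. _ * x"]
        if_distrib[of "\<lambda>x. x * _"] mult.commute cong: if_cong)
  have diff_mult: "(L - M) ** N = L ** N - M ** N"
    and mult_diff: "N ** (L - M) = N ** L - N ** M" for L M N :: "'a poly^'n^'n"
    by (simp_all add: matrix_matrix_mult_def vec_eq_iff left_diff_distrib right_diff_distrib sum_subtractf)
  have "(X - P A) ** P Q = P Q ** (X - P D)"
    by (simp add: diff_mult mult_diff P_mult[symmetric] AQ X_comm)
  then have similar: "det (X - P A) * det (P Q) = det (P Q) * det (X - P D)"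
    by (metis det_mul)
  have unit: "det (P Q) * det (P Q') = 1"
  proof -
    have "P (mat 1) = mat 1"
      by (simp add: P_def mat_def vec_eq_iff)
    then show ?thesis
      by (metis P_mult Q det_I det_mul)
  qed
  have "det (X - P A) = det (X - P A) * (det (P Q) * det (P Q'))"
    by (simp add: unit)
  also have "\<dots> = det (P Q) * det (X - P D) * det (P Q')"
    by (simp add: similar mult.assoc[symmetric])
  also have "\<dots> = det (P Q) * det (P Q') * det (X - P D)"
    by (simp only: mult_ac)
  also have "\<dots> = det (X - P D)"
    by (simp add: unit)
  finally show ?thesis
    by (simp only: charpoly)
qed

lemma eigenvalues_diagonal:
  "eigenvalues (\<chi> i j :: 'n::finite. if i = j then d i else 0) = image_mset d (mset_set UNIV)"
proof -
  have "charpoly (\<chi> i j :: 'n. if i = j then d i else 0) = (\<Prod>i\<in>UNIV. [:- d i, 1:])"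
    unfolding charpoly_def by (subst det_diagonal) auto
  then have "eigenvalues (\<chi> i j :: 'n. if i = j then d i else 0) = (\<Sum>i\<in>UNIV. {#d i#})"
    by (simp add: eigenvalues_def proots_prod)
  also have "\<dots> = image_mset d (mset_set UNIV)"
    by (induction rule: infinite_finite_induct[of _ UNIV]) auto
  finally show ?thesis .
qed

text \<open>Both sides are invariant under the passage from \<open>A\<close> to the diagonal matrix of its eigenvalues.\<close>
lemma
  fixes A :: "real^'n^'n"
  assumes "transpose A = A"
  shows prod_eigenvalues_symmetric: "(\<Prod>x\<in>#eigenvalues A. x) = det A"
    and sum_power2_eigenvalues_symmetric: "(\<Sum>x\<in>#eigenvalues A. x\<^sup>2) = trace (A ** A)"
proof -
  obtain Q d where Q: "orthogonal_matrix Q"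
    and AQ: "A ** Q = Q ** (\<chi> i j. if i = j then d i else 0)"
    by (rule symmetric_matrix_orthogonally_diagonalizable[OF assms])
  define D :: "real^'n^'n" where "D = (\<chi> i j. if i = j then d i else 0)"
  have QQ: "Q ** transpose Q = mat 1" "transpose Q ** Q = mat 1"
    using Q by (auto simp: orthogonal_matrix_def)
  have AQ: "A ** Q = Q ** D"
    using AQ by (simp add: D_def)
  have eig: "eigenvalues A = image_mset d (mset_set UNIV)"
    using charpoly_similar[OF AQ QQ(1)] eigenvalues_diagonal[of d]
    by (simp add: eigenvalues_def D_def)
  have A: "A = Q ** D ** transpose Q"
    by (simp add: AQ[symmetric] matrix_mul_assoc[symmetric] QQ(1))
  have "det A = det D"
  proof -
    have "det A * det Q = det Q * det D"
      by (metis AQ det_mul)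
    moreover have "det Q \<noteq> 0"
      using det_orthogonal_matrix[OF Q] by auto
    ultimately show ?thesis
      by simp
  qed
  also have "\<dots> = (\<Prod>i\<in>UNIV. d i)"
    unfolding D_def by (subst det_diagonal) auto
  finally show "(\<Prod>x\<in>#eigenvalues A. x) = det A"
    by (simp add: eig prod_unfold_prod_mset)
  have "A ** A = Q ** (D ** D ** transpose Q)"
    by (subst (2) A) (simp add: matrix_mul_assoc AQ)
  then have "trace (A ** A) = trace (D ** D ** transpose Q ** Q)"
    by (simp only: trace_mul_sym[of Q])
  also have "\<dots> = trace (D ** D)"
    by (simp add: matrix_mul_assoc[symmetric] QQ(2))
  also have "\<dots> = (\<Sum>i\<in>UNIV. (d i)\<^sup>2)"
    by (simp add: trace_def matrix_matrix_mult_def D_def power2_eq_square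
        if_distrib[of "\<lambda>x. _ * x"] cong: if_cong)
  finally show "(\<Sum>x\<in>#eigenvalues A. x\<^sup>2) = trace (A ** A)"
    by (simp add: eig sum_unfold_sum_mset image_mset.compositionality comp_def)
qed

section \<open>The hypervolume of a pentatope\<close>

lemma vector_4 [simp]:
  "(vector [x, y, z, w] :: 'a::zero^4) $ 1 = x"
  "(vector [x, y, z, w] :: 'a::zero^4) $ 2 = y"
  "(vector [x, y, z, w] :: 'a::zero^4) $ 3 = z"
  "(vector [x, y, z, w] :: 'a::zero^4) $ 4 = w"
  unfolding vector_def by simp_all

lemma det_4:
  "det (A::'a::comm_ring_1^4^4) =
    A$1$1 * (A$2$2 * (A$3$3 * A$4$4 - A$3$4 * A$4$3) - A$2$3 * (A$3$2 * A$4$4 - A$3$4 * A$4$2)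
      + A$2$4 * (A$3$2 * A$4$3 - A$3$3 * A$4$2))
  - A$1$2 * (A$2$1 * (A$3$3 * A$4$4 - A$3$4 * A$4$3) - A$2$3 * (A$3$1 * A$4$4 - A$3$4 * A$4$1)
      + A$2$4 * (A$3$1 * A$4$3 - A$3$3 * A$4$1))
  + A$1$3 * (A$2$1 * (A$3$2 * A$4$4 - A$3$4 * A$4$2) - A$2$2 * (A$3$1 * A$4$4 - A$3$4 * A$4$1)
      + A$2$4 * (A$3$1 * A$4$2 - A$3$2 * A$4$1))
  - A$1$4 * (A$2$1 * (A$3$2 * A$4$3 - A$3$3 * A$4$2) - A$2$2 * (A$3$1 * A$4$3 - A$3$3 * A$4$1)
      + A$2$3 * (A$3$1 * A$4$2 - A$3$2 * A$4$1))"
proof -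
  have f1234: "finite {2::4, 3, 4}" "1 \<notin> {2::4, 3, 4}"
    and f234: "finite {3::4, 4}" "2 \<notin> {3::4, 4}"
    and f34: "finite {4::4}" "3 \<notin> {4::4}"
    by auto
  show ?thesis
    unfolding det_def UNIV_4
    unfolding sum_over_permutations_insert[OF f1234]
    unfolding sum_over_permutations_insert[OF f234]
    unfolding sum_over_permutations_insert[OF f34]
    unfolding permutes_sing
    by (simp add: sign_swap_id permutation_swap_id permutation_compose sign_compose sign_id
        swap_id_eq algebra_simps)
qed

lemma edge_matrix_nth:
  "edge_matrix p $ i $ j = (vector [p 2 - p 1, p 3 - p 1, p 4 - p 1, p 5 - p 1] :: real^4^4) $ j $ i"
  by (simp add: edge_matrix_def transpose_def)

lemma column_edge_matrix:
  "column j (edge_matrix p) = (vector [p 2 - p 1, p 3 - p 1, p 4 - p 1, p 5 - p 1] :: real^4^4) $ j"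
  by (simp add: column_def edge_matrix_nth)

lemma atLeastAtMost_1_5: "{1..5::nat} = {1, 2, 3, 4, 5}"
  by auto

text \<open>A simplex is an affine image of the standard simplex, whose hypervolume is \<open>1/4!\<close>.\<close>
lemma hypervolume_eq_det:
  assumes "inj_on p {1..5}"
  shows "hypervolume p = \<bar>det (edge_matrix p)\<bar> / 24"
proof -
  define f :: "4 \<Rightarrow> real^4" where "f j = (vector [p 2, p 3, p 4, p 5] :: real^4^4) $ j" for j
  have f: "f 1 = p 2" "f 2 = p 3" "f 3 = p 4" "f 4 = p 5"
    by (simp_all add: f_def)
  have "finite (p ` {1..5})" "card (p ` {1..5}) = Suc CARD(4)" "p 1 \<in> p ` {1..5}"
    using assms by (auto simp: card_image)
  moreover have "bij_betw f UNIV (p ` {1..5} - {p 1})"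
    using assms unfolding bij_betw_def inj_on_def UNIV_4 atLeastAtMost_1_5
    by (auto simp: f)
  ultimately have "measure lborel (convex hull (p ` {1..5}))
      = \<bar>det (\<chi> i j. f j $ i - p 1 $ i :: real^4^4)\<bar> / fact CARD(4)"
    by (rule content_simplex)
  also have "(\<chi> i j. f j $ i - p 1 $ i) = edge_matrix p"
    by (simp add: vec_eq_iff forall_4 edge_matrix_nth f)
  finally show ?thesis
    by (simp add: hypervolume_def fact_numeral finite_imp_compact_convex_hull compact_imp_closed
        measure_completion)
qed

text \<open>
  Affine independence of the vertices means linear independence of the edge vectors at \<open>p 1\<close>, so
  the edge matrix has full rank.
\<close>
lemma det_edge_matrix_neq_0:
  assumes "pentatope p"
  shows "det (edge_matrix p) \<noteq> 0"
proof -
  have inj: "inj_on p {1..5}" and aff: "\<not> affine_dependent (p ` {1..5})"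
    using assms by (auto simp: pentatope_def)
  define E where "E = (\<lambda>x. - p 1 + x) ` (p ` {1..5} - {p 1})"
  have "columns (edge_matrix p) = (\<lambda>j. column j (edge_matrix p)) ` UNIV"
    by (auto simp: columns_def)
  also have "\<dots> = {p 2 - p 1, p 3 - p 1, p 4 - p 1, p 5 - p 1}"
    unfolding UNIV_4 by (simp add: column_edge_matrix)
  also have "\<dots> = E"
    using inj unfolding E_def inj_on_def atLeastAtMost_1_5 by auto
  finally have "columns (edge_matrix p) = E" .
  moreover have "independent E"
    unfolding E_def using aff affine_dependent_iff_dependent2[of "p 1" "p ` {1..5}"] by auto
  moreover have "card E = 4"
  proof -
    have "card E = card (p ` {1..5} - {p 1})"
      unfolding E_def by (intro card_image) (auto simp: inj_on_def)
    also have "\<dots> = 4"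
      using inj by (simp add: card_Diff_singleton card_image)
    finally show ?thesis .
  qed
  ultimately show ?thesis
    by (simp add: det_eq_0_rank column_rank_def dim_eq_card_independent)
qed

section \<open>The comparison matrix\<close>

lemma matrix_inv:
  fixes A :: "'a::semiring_1^'n^'m"
  assumes "invertible A"
  shows "A ** matrix_inv A = mat 1" "matrix_inv A ** A = mat 1"
  using someI_ex[OF assms[unfolded invertible_def]] by (simp_all add: matrix_inv_def)

lemma transpose_comparison_matrix: "transpose (comparison_matrix R T) = comparison_matrix R T"
  by (simp add: comparison_matrix_def matrix_transpose_mul transpose_transpose matrix_mul_assoc)

lemma det_comparison_matrix:
  assumes "det R \<noteq> 0"
  shows "det (comparison_matrix R T) = (det T / det R)\<^sup>2"
proof -
  have "det R * det (matrix_inv R) = 1"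
    using assms by (metis det_I det_mul invertible_det_nz matrix_inv(1))
  then have "det (matrix_inv R) = 1 / det R"
    using assms by (simp add: field_simps)
  then show ?thesis
    by (simp add: comparison_matrix_def det_mul power2_eq_square)
qed

text \<open>
  A left inverse \<open>K\<close> of the Gram matrix of \<open>R\<close> equals \<open>R\<^sup>-\<^sup>1 (R\<^sup>-\<^sup>1)\<^sup>T\<close>, so moving the leading factor
  \<open>(R\<^sup>-\<^sup>1)\<^sup>T\<close> of \<open>A\<^sup>2\<close> to the end of the trace leaves only the Gram matrix of \<open>T\<close> and \<open>K\<close>. In this
  form the coordinates of \<open>R\<close> and \<open>T\<close> enter only through inner products of edges.
\<close>
lemma trace_comparison_matrix_square:
  fixes R T K :: "real^4^4"
  assumes K: "K ** (transpose R ** R) = mat 1"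
  defines "M \<equiv> (transpose T ** T) ** K"
  shows "trace (comparison_matrix R T ** comparison_matrix R T) = trace (M ** M)"
proof -
  define R' where "R' = matrix_inv R"
  have "invertible R"
    using K by (metis invertible_left_inverse matrix_mul_assoc)
  then have R': "R ** R' = mat 1"
    by (simp add: R'_def matrix_inv)
  then have "transpose R' ** transpose R = mat 1"
    by (metis matrix_transpose_mul transpose_mat)
  then have "transpose R ** transpose R' = mat 1"
    by (simp add: matrix_left_right_inverse)
  then have "transpose R ** R ** (R' ** transpose R') = mat 1"
    by (simp add: matrix_mul_assoc[symmetric]) (simp add: matrix_mul_assoc R')
  then have "K = R' ** transpose R'"
    using K by (metis matrix_mul_assoc matrix_mul_lid matrix_mul_rid)
  moreover have "comparison_matrix R T ** comparison_matrix R T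
      = transpose R' ** (transpose T ** T ** R' ** transpose R' ** (transpose T ** T) ** R')"
    by (simp add: comparison_matrix_def R'_def matrix_mul_assoc)
  ultimately show ?thesis
    by (simp only: M_def) (subst trace_mul_sym, simp only: matrix_mul_assoc)
qed

section \<open>The regular pentatope\<close>

context
  fixes v a :: real and R :: "real^4^4"
  assumes v: "v > 0"
  defines "a \<equiv> root 4 (96 * v / sqrt 5)"
    and "R \<equiv> edge_matrix (regular_pentatope v)"
begin

lemma regular_edge_pos: "a > 0"
  using v by (simp add: a_def)

lemma regular_edge_power4: "a ^ 4 = 96 * v / sqrt 5"
  using v by (simp add: a_def)

lemma regular_edge_matrix:
  "R = transpose (vector
    [vector [a * sqrt 3 / 2, - a / 2, 0, 0],
     vector [a * sqrt 3 / 2, a / 2, 0, 0],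
     vector [a * sqrt 3 / 3, 0, a * sqrt 6 / 3, 0],
     vector [a * sqrt 3 / 3, 0, a * sqrt 6 / 12, a * sqrt 10 / 4]])"
proof -
  have "regular_pentatope v i =
    [vector [- a * sqrt 3 / 2, 0, 0, 0],
     vector [0, - a / 2, 0, 0],
     vector [0, a / 2, 0, 0],
     vector [- a * sqrt 3 / 6, 0, a * sqrt 6 / 3, 0],
     vector [- a * sqrt 3 / 6, 0, a * sqrt 6 / 12, a * sqrt 10 / 4]] ! (i - 1)" for i
    by (simp only: regular_pentatope_def Let_def a_def)
  then show ?thesis
    by (simp add: R_def edge_matrix_def vec_eq_iff forall_4 transpose_def field_simps)
qed

lemma det_edge_matrix_regular: "det R = 24 * v"
proof -
  have "det R = a ^ 4 * (sqrt 3 * sqrt 6 * sqrt 10) / 24"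
    by (simp add: regular_edge_matrix det_4 transpose_def power4_eq_xxxx)
  also have "sqrt 3 * sqrt 6 * sqrt 10 = 6 * sqrt 5"
    by (simp add: real_sqrt_mult[symmetric] real_sqrt_eq_iff real_sqrt_unique)
  finally show ?thesis
    by (simp add: regular_edge_power4)
qed

text \<open>All edges have length \<open>a\<close> and meet at an angle of sixty degrees.\<close>
lemma gram_regular:
  "transpose R ** R = (\<chi> i j. if i = j then a\<^sup>2 else a\<^sup>2 / 2)"
proof -
  have "sqrt 3 * sqrt 3 = 3" "sqrt 6 * sqrt 6 = 6" "sqrt 10 * sqrt 10 = (10::real)"
    by simp_all
  then show ?thesis
    unfolding matrix_mult_transpose_dot_column vec_eq_iff forall_4
    by (simp add: regular_edge_matrix column_def transpose_def inner_vec_def sum_4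
        power2_eq_square field_simps)
qed

text \<open>
  With \<open>J\<close> the all-ones matrix of size \<open>4\<close> one has \<open>J\<^sup>2 = 4 J\<close>, so \<open>(I - J/5) (I + J) = I\<close>.
\<close>
lemma gram_regular_left_inverse:
  "(2 / a\<^sup>2) *\<^sub>R (\<chi> i j. if i = j then 4 / 5 else - 1 / 5) ** (transpose R ** R) = mat 1"
  using regular_edge_pos
  unfolding gram_regular vec_eq_iff forall_4
  by (simp add: matrix_matrix_mult_def sum_4 mat_def)

end

section \<open>The quality in terms of the edge lengths\<close>

text \<open>
  By the law of cosines every squared edge length is a linear expression in the ten inner
  products of edge vectors at \<open>p 1\<close>. Both sides thereby become quadratic forms in these ten
  quantities, and comparing coefficients gives the identity. The factor is fixed by the regular
  pentatope with unit edges, where \<open>\<Theta> = 3600\<close> and the trace is \<open>1\<close>.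
\<close>
lemma Theta_eq_trace:
  fixes p :: "nat \<Rightarrow> real^4"
  defines "G \<equiv> transpose (edge_matrix p) ** edge_matrix p"
    and "K \<equiv> (\<chi> i j. if i = j then 4 / 5 else - 1 / 5) :: real^4^4"
  shows "Theta (\<lambda>i. (edge_length p i)\<^sup>2) = 3600 * trace ((G ** K) ** (G ** K))"
proof -
  define e where "e j = p j - p 1" for j
  have dist: "(norm (p k - p j))\<^sup>2 = e k \<bullet> e k + e j \<bullet> e j - 2 * (e j \<bullet> e k)" for j k
    by (simp add: power2_norm_eq_inner e_def inner_diff_left inner_diff_right inner_commute)
  have e1: "e (Suc 0) = 0"
    by (simp add: e_def)
  have G: "G $ i $ j = column i (edge_matrix p) \<bullet> column j (edge_matrix p)" for i j
    by (simp add: G_def matrix_mult_transpose_dot_column)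
  note column = column_edge_matrix[of _ p, folded e_def]
  have sym: "e 3 \<bullet> e 2 = e 2 \<bullet> e 3" "e 4 \<bullet> e 2 = e 2 \<bullet> e 4" "e 5 \<bullet> e 2 = e 2 \<bullet> e 5"
    "e 4 \<bullet> e 3 = e 3 \<bullet> e 4" "e 5 \<bullet> e 3 = e 3 \<bullet> e 5" "e 5 \<bullet> e 4 = e 4 \<bullet> e 5"
    by (simp_all add: inner_commute)
  have "trace ((G ** K) ** (G ** K)) = (\<Sum>i\<in>UNIV. \<Sum>j\<in>UNIV. (G ** K) $ i $ j * (G ** K) $ j $ i)"
    by (simp add: trace_def matrix_matrix_mult_def)
  also have "\<dots> = (\<Sum>i\<in>UNIV. \<Sum>j\<in>UNIV.
      (G $ i $ j - (\<Sum>k\<in>UNIV. G $ i $ k) / 5) * (G $ j $ i - (\<Sum>k\<in>UNIV. G $ j $ k) / 5))"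
  proof -
    have "(G ** K) $ i $ j = G $ i $ j - (\<Sum>k\<in>UNIV. G $ i $ k) / 5" for i j
      using exhaust_4[of j] by (auto simp: K_def matrix_matrix_mult_def sum_4 field_simps)
    then show ?thesis
      by (simp only:)
  qed
  finally have trace: "trace ((G ** K) ** (G ** K)) = \<dots>" .
  show ?thesis
    unfolding Theta_def edge_length_def trace
    by (simp add: dist e1 G column sum_4 sym) (simp add: power2_eq_square field_simps)
qed

theorem corollary6p3:
  fixes p :: "nat \<Rightarrow> real^4"
  assumes "pentatope p"
  shows "quality p =
    6 * 5 powr (3/4) * sqrt (384 * hypervolume p / Theta (\<lambda>i. (edge_length p i)\<^sup>2))"
proof -
  define v where "v = hypervolume p"
  define \<theta> where "\<theta> = Theta (\<lambda>i. (edge_length p i)\<^sup>2)"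
  define T where "T = edge_matrix p"
  define R where "R = edge_matrix (regular_pentatope v)"
  define A where "A = comparison_matrix R T"
  define a where "a = root 4 (96 * v / sqrt 5)"
  have det_T: "\<bar>det T\<bar> = 24 * v"
    using assms by (simp add: T_def v_def hypervolume_eq_det pentatope_def)
  then have v: "v > 0"
    using det_edge_matrix_neq_0[OF assms] by (simp add: T_def)
  have det_R: "det R = 24 * v"
    unfolding R_def using v by (rule det_edge_matrix_regular)
  have sym: "transpose A = A"
    by (simp add: A_def transpose_comparison_matrix)
  have "det A = (\<bar>det T\<bar> / det R)\<^sup>2"
    using det_R v by (simp add: A_def det_comparison_matrix power_divide)
  then have det_A: "det A = 1"
    using det_T det_R v by simp
  have "trace (A ** A) = (2 / a\<^sup>2)\<^sup>2 * (\<theta> / 3600)"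
  proof -
    define G where "G = transpose T ** T"
    define K :: "real^4^4" where "K = (\<chi> i j. if i = j then 4 / 5 else - 1 / 5)"
    have "(2 / a\<^sup>2) *\<^sub>R K ** (transpose R ** R) = mat 1"
      unfolding K_def R_def a_def using v by (rule gram_regular_left_inverse)
    then have "trace (A ** A) = trace ((G ** ((2 / a\<^sup>2) *\<^sub>R K)) ** (G ** ((2 / a\<^sup>2) *\<^sub>R K)))"
      unfolding A_def G_def by (rule trace_comparison_matrix_square)
    also have "\<dots> = (2 / a\<^sup>2)\<^sup>2 * trace ((G ** K) ** (G ** K))"
      by (simp add: matrix_scalar_ac scalar_matrix_assoc[symmetric] trace_def sum_distrib_left
          power2_eq_square)
    also have "trace ((G ** K) ** (G ** K)) = \<theta> / 3600"
      by (simp add: \<theta>_def Theta_eq_trace G_def K_def T_def)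
    finally show ?thesis .
  qed
  also have "(2 / a\<^sup>2)\<^sup>2 = 4 / a ^ 4"
    by (simp add: power_divide flip: power_mult)
  also have "a ^ 4 = 96 * v / sqrt 5"
    unfolding a_def using v by (rule regular_edge_power4)
  finally have trace_A: "trace (A ** A) = sqrt 5 * \<theta> / (86400 * v)"
    by simp
  have "quality p = 2 * root 4 (det A) / sqrt (trace (A ** A))"
    unfolding prod_eigenvalues_symmetric[OF sym, symmetric]
      sum_power2_eigenvalues_symmetric[OF sym, symmetric]
    by (simp add: quality_def Let_def A_def R_def T_def v_def)
  also have "\<dots> = sqrt (4 / trace (A ** A))"
    by (simp add: det_A real_sqrt_divide)
  also have "4 / trace (A ** A) = 36 * (5 powr (3/4))\<^sup>2 * (384 * v / \<theta>)"
  proof -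
    have "(5 powr (3/4))\<^sup>2 = 5 powr (1 + 1/2 :: real)"
      by (simp add: powr_power)
    also have "\<dots> = 5 * sqrt 5"
      unfolding powr_add by (simp add: powr_half_sqrt)
    finally show ?thesis
      \<comment> \<open>For \<open>\<theta> = 0\<close> both sides would be quotients by zero, hence zero.\<close>
      using v by (cases "\<theta> = 0") (simp_all add: trace_A field_simps)
  qed
  also have "sqrt \<dots> = 6 * 5 powr (3/4) * sqrt (384 * v / \<theta>)"
    by (simp only: real_sqrt_mult) simp
  finally show ?thesis
    by (simp only: v_def \<theta>_def)
qed

end
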